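(* Let $\ell$ be a positive integer and put $$\begin{aligned} F_1&=x_3x_1(x_3^{q-1}-x_1^{q-1}),\\ F_2&=x_4x_2x_1(x_4^{q-1}-x_2^{q-1}x_1^{(q-1)\ell}),\\ F_3&=x_4x_3x_2(x_4^{q-1}-x_3^{(q-1)\ell}x_2^{q-1}),\\ F_4&=x_4^{q}x_2-x_4x_3^{(q-1)\ell}x_2^{q}+x_4x_3^{q-1}x_2^{q}x_1^{(q-1)(\ell-1)}-x_4x_2^{q}x_1^{(q-1)\ell},\\ F_4'&=x_4^{2q-1}x_2-x_4x_3^{2(q-1)}x_2^{2q-1}+x_4x_3^{q-1}x_2^{2q-1}x_1^{q-1}-x_4x_2^{2q-1}x_1^{2(q-1)}. \end{aligned}$$ Then minimal generating sets of the vanishing ideals are given as follows: (i) if $\ell>1$, then $I(\mathcal{H}_\ell(\mathbb{F}_q))=\langle F_1,F_2,F_3,F_4\rangle=\langle F_1,F_4\rangle$, and $\{F_1,F_4\}$ is a minimal generating set; (ii) if $\ell=1$, then $I(\mathcal{H}_1(\mathbb{F}_q))=\langle F_1,F_2,F_3,F_4'\rangle$, and $\{F_1,F_2,F_3,F_4'\}$ is a minimal generating set.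
   Context: $\mathbb{F}_q$ is a finite field, $\mathbb{K}=\overline{\mathbb{F}}_q$ an algebraic closure. $\mathcal{H}_\ell$ is the Hirzebruch surface, i.e. the toric surface whose fan has primitive ray generators $\mathbf{v}_1=(1,0)$, $\mathbf{v}_2=(0,1)$, $\mathbf{v}_3=(-1,\ell)$, $\mathbf{v}_4=(0,-1)$. Its Cox ring $S=\mathbb{F}_q[x_1,x_2,x_3,x_4]$ is $\mathbb{Z}^2$-graded by $\deg(x_1)=\deg(x_3)=(1,0)$, $\deg(x_2)=(0,1)$, $\deg(x_4)=(\ell,1)$; "homogeneous" refers to this grading. The group $G=\{(t_1,t_2,t_1,t_1^{\ell}t_2):t_1,t_2\in\mathbb{K}^*\}$ acts on $\mathbb{K}^4$ by coordinatewise multiplication. With $B=\langle x_1,x_3\rangle\cap\langle x_2,x_4\rangle$, the set of $\mathbb{F}_q$-rational points is identified with $\mathcal{H}_\ell(\mathbb{F}_q)=(\mathbb{F}_q^4\setminus V(B))/G$, the set of $G$-orbits $[P]=G\cdot P$ of points $P\in\mathbb{F}_q^4\setminus V(B)$. The vanishing ideal $I(\mathcal{H}_\ell(\mathbb{F}_q))\subseteq S$ is the ideal generated by the homogeneous polynomials in $S$ vanishing at all points of $\mathbb{F}_q^4\setminus V(B)$. *)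

theory Defs
  imports
    "HOL-Library.Numeral_Type"
    "HOL-Library.Poly_Mapping"
    "HOL-Algebra.Algebraic_Closure_Type"
begin

text \<open>
  The field with \<open>q\<close> elements is a type \<open>'a :: {field, finite}\<close> with \<open>q = CARD('a)\<close>; its algebraic
  closure is \<open>'a alg_closure\<close>. The four coordinates are indexed by the type \<open>4\<close>, whose elements are
  \<open>1, 2, 3, 4\<close> (where \<open>4 = 0\<close>). A monomial is its exponent vector \<open>4 \<Rightarrow>\<^sub>0 nat\<close>, and the product of
  \<open>cox_ring\<close> is the convolution product of \<open>HOL-Library.Poly_Mapping\<close>, i.e. the usual product of
  polynomials.
\<close>

type_synonym 'a cox_ring = "(4 \<Rightarrow>\<^sub>0 nat) \<Rightarrow>\<^sub>0 'a"

definition Var :: "4 \<Rightarrow> 'a::comm_ring_1 cox_ring" where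
  "Var i = Poly_Mapping.single (Poly_Mapping.single i 1) 1"

definition eval_at :: "'a::comm_ring_1 cox_ring \<Rightarrow> (4 \<Rightarrow> 'a) \<Rightarrow> 'a" where
  "eval_at f P = (\<Sum>m\<in>Poly_Mapping.keys f.
     Poly_Mapping.lookup f m * (\<Prod>i\<in>UNIV. P i ^ Poly_Mapping.lookup m i))"

definition var_deg :: "nat \<Rightarrow> 4 \<Rightarrow> int \<times> int" where
  "var_deg l i = (if i = 2 then (0, 1) else if i = 4 then (int l, 1) else (1, 0))"

definition mon_deg :: "nat \<Rightarrow> (4 \<Rightarrow>\<^sub>0 nat) \<Rightarrow> int \<times> int" where
  "mon_deg l m =
     (\<Sum>i\<in>UNIV. int (Poly_Mapping.lookup m i) * fst (var_deg l i),
      \<Sum>i\<in>UNIV. int (Poly_Mapping.lookup m i) * snd (var_deg l i))"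

definition homogeneous :: "nat \<Rightarrow> 'a::comm_ring_1 cox_ring \<Rightarrow> bool" where
  "homogeneous l f \<longleftrightarrow> (\<exists>d. \<forall>m\<in>Poly_Mapping.keys f. mon_deg l m = d)"

text \<open>
  The ideal generated by a set is its span in the ring viewed as a module over itself. The
  qualified name is needed because HOL-Algebra has another locale called \<open>module\<close>.
\<close>

definition ideal_gen :: "'r::comm_ring_1 set \<Rightarrow> 'r set" where
  "ideal_gen A = Modules.module.span (*) A"

definition minimal_generating_set :: "'r::comm_ring_1 set \<Rightarrow> 'r set \<Rightarrow> bool" where
  "minimal_generating_set A I \<longleftrightarrow> ideal_gen A = I \<and> (\<forall>A'. A' \<subset> A \<longrightarrow> ideal_gen A' \<noteq> I)"

definition irrelevant_ideal :: "'a::comm_ring_1 cox_ring set" where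
  "irrelevant_ideal = ideal_gen {Var 1, Var 3} \<inter> ideal_gen {Var 2, Var 4}"

definition zero_locus :: "'a::comm_ring_1 cox_ring set \<Rightarrow> (4 \<Rightarrow> 'a) set" where
  "zero_locus J = {P. \<forall>f\<in>J. eval_at f P = 0}"

definition torus :: "nat \<Rightarrow> (4 \<Rightarrow> 'a::field alg_closure) set" where
  "torus l = {g. \<exists>t1 t2. t1 \<noteq> 0 \<and> t2 \<noteq> 0 \<and>
     g 1 = t1 \<and> g 2 = t2 \<and> g 3 = t1 \<and> g 4 = t1 ^ l * t2}"

definition torus_orbit :: "nat \<Rightarrow> (4 \<Rightarrow> 'a::field) \<Rightarrow> (4 \<Rightarrow> 'a alg_closure) set" where
  "torus_orbit l P = (\<lambda>g i. g i * to_ac (P i)) ` torus l"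

definition hirzebruch_points :: "nat \<Rightarrow> (4 \<Rightarrow> 'a::field alg_closure) set set" where
  "hirzebruch_points l = torus_orbit l ` (UNIV - zero_locus irrelevant_ideal)"

text \<open>
  Vanishing at \<open>[P]\<close> means vanishing at every representative of \<open>[P]\<close> in the affine space over the
  ground field minus the zero locus of the irrelevant ideal.
\<close>

definition vanishing_ideal ::
  "nat \<Rightarrow> (4 \<Rightarrow> 'a::field alg_closure) set set \<Rightarrow> 'a cox_ring set" where
  "vanishing_ideal l Y = ideal_gen
     {f. homogeneous l f \<and>
         (\<forall>P. P \<notin> zero_locus irrelevant_ideal \<and> torus_orbit l P \<in> Y \<longrightarrow> eval_at f P = 0)}"

context
  fixes l q :: nat
begin

definition F1 :: "'a::comm_ring_1 cox_ring" where
  "F1 = Var 3 * Var 1 * (Var 3 ^ (q - 1) - Var 1 ^ (q - 1))"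

definition F2 :: "'a::comm_ring_1 cox_ring" where
  "F2 = Var 4 * Var 2 * Var 1 * (Var 4 ^ (q - 1) - Var 2 ^ (q - 1) * Var 1 ^ ((q - 1) * l))"

definition F3 :: "'a::comm_ring_1 cox_ring" where
  "F3 = Var 4 * Var 3 * Var 2 * (Var 4 ^ (q - 1) - Var 3 ^ ((q - 1) * l) * Var 2 ^ (q - 1))"

definition F4 :: "'a::comm_ring_1 cox_ring" where
  "F4 = Var 4 ^ q * Var 2 - Var 4 * Var 3 ^ ((q - 1) * l) * Var 2 ^ q
      + Var 4 * Var 3 ^ (q - 1) * Var 2 ^ q * Var 1 ^ ((q - 1) * (l - 1))
      - Var 4 * Var 2 ^ q * Var 1 ^ ((q - 1) * l)"

definition F4' :: "'a::comm_ring_1 cox_ring" where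
  "F4' = Var 4 ^ (2 * q - 1) * Var 2 - Var 4 * Var 3 ^ (2 * (q - 1)) * Var 2 ^ (2 * q - 1)
      + Var 4 * Var 3 ^ (q - 1) * Var 2 ^ (2 * q - 1) * Var 1 ^ (q - 1)
      - Var 4 * Var 2 ^ (2 * q - 1) * Var 1 ^ (2 * (q - 1))"

end

end

theory Submission
  imports Defs "HOL-Analysis.Cartesian_Space"
begin

text \<open>
  Order monomials by the exponent of \<open>x\<^sub>4\<close>, then by that of \<open>x\<^sub>3\<close>. Dividing a homogeneous
  polynomial by the claimed generators leaves a homogeneous remainder, supported on monomials that
  no leading monomial divides. If the polynomial vanishes at all rational points, so does the
  remainder; for fixed \<open>x\<^sub>1, x\<^sub>3\<close> it is a form in \<open>x\<^sub>2, x\<^sub>4\<close> with exponents small enough for it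
  to be zero as soon as it vanishes on \<open>F\<^sub>q\<^sup>2 - {0}\<close>, and then its coefficients are such forms in
  \<open>x\<^sub>1, x\<^sub>3\<close>. Hence the remainder is zero. Minimality holds because the leading monomial of each
  generator is not divisible by any monomial occurring in the others.
\<close>

section \<open>Ideals generated by sets\<close>

lemma module_times: "Modules.module ((*) :: 'r::comm_ring_1 \<Rightarrow> 'r \<Rightarrow> 'r)"
  by unfold_locales (simp_all add: algebra_simps)

lemma ideal_gen_base: "x \<in> A \<Longrightarrow> x \<in> ideal_gen A"
  unfolding ideal_gen_def by (rule module.span_base[OF module_times])

lemma ideal_gen_zero: "0 \<in> ideal_gen A"
  unfolding ideal_gen_def by (rule module.span_zero[OF module_times])

lemma ideal_gen_add: "x \<in> ideal_gen A \<Longrightarrow> y \<in> ideal_gen A \<Longrightarrow> x + y \<in> ideal_gen A"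
  unfolding ideal_gen_def by (rule module.span_add[OF module_times])

lemma ideal_gen_mult_left: "x \<in> ideal_gen A \<Longrightarrow> c * x \<in> ideal_gen A"
  unfolding ideal_gen_def by (rule module.span_scale[OF module_times])

lemma ideal_gen_mult_right: "x \<in> ideal_gen A \<Longrightarrow> x * c \<in> ideal_gen A"
  using ideal_gen_mult_left[of x A c] by (simp add: mult.commute)

lemma ideal_gen_mono: "A \<subseteq> B \<Longrightarrow> ideal_gen A \<subseteq> ideal_gen B"
  unfolding ideal_gen_def by (rule module.span_mono[OF module_times])

lemma ideal_gen_minimal:
  assumes "A \<subseteq> T" "0 \<in> T"
    and "\<And>x y. x \<in> T \<Longrightarrow> y \<in> T \<Longrightarrow> x + y \<in> T" and "\<And>c x. x \<in> T \<Longrightarrow> c * x \<in> T"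
  shows "ideal_gen A \<subseteq> T"
  unfolding ideal_gen_def
  by (rule module.span_minimal[OF module_times])
     (use assms in \<open>auto simp: module.subspace_def[OF module_times]\<close>)

lemma ideal_gen_subset_ideal_gen: "A \<subseteq> ideal_gen B \<Longrightarrow> ideal_gen A \<subseteq> ideal_gen B"
  by (rule ideal_gen_minimal) (auto intro: ideal_gen_zero ideal_gen_add ideal_gen_mult_left)

text \<open>A proper subset misses some \<open>x\<close> and hence lies in \<open>A - {x}\<close>,
  so by monotonicity it is enough to test the sets with one element removed.\<close>

lemma minimal_generating_setI:
  assumes "ideal_gen A = I" and "\<And>x. x \<in> A \<Longrightarrow> x \<notin> ideal_gen (A - {x})"
  shows "minimal_generating_set A I"
  unfolding minimal_generating_set_def
proof (intro conjI allI impI)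
  fix A' assume "A' \<subset> A"
  then obtain x where x: "x \<in> A" "A' \<subseteq> A - {x}"
    by blast
  then have "x \<notin> ideal_gen A'"
    using assms(2) ideal_gen_mono by blast
  then show "ideal_gen A' \<noteq> I"
    using x(1) assms(1) ideal_gen_base by blast
qed (fact assms(1))


section \<open>Polynomials as finitely supported functions\<close>

lemma poly_mapping_expansion:
  fixes f :: "'e \<Rightarrow>\<^sub>0 'b::comm_monoid_add"
  shows "(\<Sum>e\<in>Poly_Mapping.keys f. Poly_Mapping.single e (Poly_Mapping.lookup f e)) = f"
  by (rule poly_mapping_eqI)
     (auto simp: lookup_sum lookup_single when_def sum.delta in_keys_iff)

text \<open>The last case speaks only of terms that occur in \<open>f\<close>, so facts about the
  support of \<open>f\<close> remain available in the induction.\<close>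

lemma poly_mapping_induct_keys [case_names zero add single]:
  fixes f :: "'e \<Rightarrow>\<^sub>0 'b::comm_monoid_add"
  assumes "P 0" and "\<And>f g. P f \<Longrightarrow> P g \<Longrightarrow> P (f + g)"
    and "\<And>e. e \<in> Poly_Mapping.keys f \<Longrightarrow> P (Poly_Mapping.single e (Poly_Mapping.lookup f e))"
  shows "P f"
proof -
  have "P (\<Sum>e\<in>A. Poly_Mapping.single e (Poly_Mapping.lookup f e))"
    if "finite A" "A \<subseteq> Poly_Mapping.keys f" for A
    using that by (induction A rule: finite_induct) (auto intro: assms)
  from this[OF finite_keys subset_refl] show ?thesis
    by (simp only: poly_mapping_expansion)
qed

lemma keys_add_subset:
  "Poly_Mapping.keys f \<subseteq> A \<Longrightarrow> Poly_Mapping.keys g \<subseteq> A \<Longrightarrow> Poly_Mapping.keys (f + g) \<subseteq> A"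
  using keys_add[of f g] by blast

lemma keys_diff_subset:
  "Poly_Mapping.keys f \<subseteq> A \<Longrightarrow> Poly_Mapping.keys g \<subseteq> A \<Longrightarrow> Poly_Mapping.keys (f - g) \<subseteq> A"
  using keys_diff[of f g] by blast

lemma eval_at_superset:
  assumes "finite A" "Poly_Mapping.keys f \<subseteq> A"
  shows "eval_at f P =
    (\<Sum>e\<in>A. Poly_Mapping.lookup f e * (\<Prod>i\<in>UNIV. P i ^ Poly_Mapping.lookup e i))"
  unfolding eval_at_def by (rule sum.mono_neutral_left) (use assms in \<open>auto simp: in_keys_iff\<close>)

lemma eval_at_0 [simp]: "eval_at 0 P = 0"
  by (simp add: eval_at_def)

lemma eval_at_add [simp]: "eval_at (f + g) P = eval_at f P + eval_at g P"
proof -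
  let ?A = "Poly_Mapping.keys f \<union> Poly_Mapping.keys g"
  show ?thesis
    using keys_add[of f g]
    by (simp add: eval_at_superset[of ?A] lookup_add distrib_right sum.distrib)
qed

lemma eval_at_uminus [simp]: "eval_at (- f) P = - eval_at f P"
  by (simp add: eval_at_def sum_negf)

lemma eval_at_diff [simp]: "eval_at (f - g) P = eval_at f P - eval_at g P"
  using eval_at_add[of f "- g" P] by simp

lemma eval_at_single:
  "eval_at (Poly_Mapping.single e c) P = c * (\<Prod>i\<in>UNIV. P i ^ Poly_Mapping.lookup e i)"
  by (simp add: eval_at_def)

lemma eval_at_mult [simp]: "eval_at (f * g) P = eval_at f P * eval_at g P"
proof (induction f rule: poly_mapping_induct_keys)
  case (single e)
  show ?case
  proof (induction g rule: poly_mapping_induct_keys)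
    case (single e')
    show ?case
      by (simp add: mult_single eval_at_single lookup_add power_add prod.distrib)
  qed (simp_all add: distrib_left)
qed (simp_all add: distrib_right)

lemma eval_at_Var [simp]: "eval_at (Var i) P = P i"
proof -
  have "(\<Prod>j\<in>UNIV. P j ^ Poly_Mapping.lookup (Poly_Mapping.single i 1) j)
      = (\<Prod>j\<in>UNIV. if j = i then P j else 1)"
    by (intro prod.cong) (auto simp: lookup_single when_def)
  then show ?thesis
    by (simp add: Var_def eval_at_single prod.delta)
qed

lemma eval_at_1 [simp]: "eval_at 1 P = 1"
  using eval_at_single[of 0 1 P] by simp

lemma eval_at_power [simp]: "eval_at (f ^ n) P = eval_at f P ^ n"
  by (induction n) simp_all

lemma eval_at_ideal_gen:
  assumes "f \<in> ideal_gen A" "\<And>g. g \<in> A \<Longrightarrow> eval_at g P = 0"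
  shows "eval_at f P = 0"
proof -
  have "ideal_gen A \<subseteq> {f. eval_at f P = 0}"
    by (rule ideal_gen_minimal) (auto simp: assms(2))
  then show ?thesis
    using assms(1) by blast
qed

text \<open>A multiple of a monomial that does not divide \<open>m\<close> does not divide
  \<open>m\<close> either. So the polynomials without any monomial dividing \<open>m\<close> form an
  ideal, and \<open>m\<close> itself occurs in none of them.\<close>

lemma lookup_ideal_gen_eq_0:
  fixes m :: "4 \<Rightarrow>\<^sub>0 nat"
  assumes "f \<in> ideal_gen A"
    and "\<And>g e. g \<in> A \<Longrightarrow> e \<in> Poly_Mapping.keys g \<Longrightarrow>
           \<exists>i. Poly_Mapping.lookup m i < Poly_Mapping.lookup e i"
  shows "Poly_Mapping.lookup f m = 0"
proof -
  let ?D = "{e. \<exists>i. Poly_Mapping.lookup m i < Poly_Mapping.lookup e i}"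
  have "ideal_gen A \<subseteq> {f. Poly_Mapping.keys f \<subseteq> ?D}"
  proof (rule ideal_gen_minimal)
    fix c x :: "'a cox_ring"
    assume "x \<in> {f. Poly_Mapping.keys f \<subseteq> ?D}"
    then have x: "Poly_Mapping.keys x \<subseteq> ?D"
      by simp
    have "a + b \<in> ?D" if "b \<in> ?D" for a b
      using that by (auto simp: lookup_add intro: trans_less_add2)
    then have "{a + b |a b. a \<in> Poly_Mapping.keys c \<and> b \<in> Poly_Mapping.keys x} \<subseteq> ?D"
      using x by blast
    then show "c * x \<in> {f. Poly_Mapping.keys f \<subseteq> ?D}"
      using keys_mult[of c x] by simp
  qed (use assms(2) in \<open>auto dest: subsetD[OF keys_add]\<close>)
  then have "m \<notin> Poly_Mapping.keys f"
    using assms(1) by auto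
  then show ?thesis
    by (simp add: in_keys_iff)
qed


section \<open>Multivariate division\<close>

lemma mon_deg_add: "mon_deg l (u + v) = mon_deg l u + mon_deg l v"
  by (simp add: mon_deg_def lookup_add distrib_right sum.distrib)

text \<open>Among monomials of one degree the exponents of \<open>x4\<close> and \<open>x3\<close>
  determine the other two, so there this is a strict total order.\<close>

definition mon_order :: "((4 \<Rightarrow>\<^sub>0 nat) \<times> (4 \<Rightarrow>\<^sub>0 nat)) set" where
  "mon_order = measures [\<lambda>e. Poly_Mapping.lookup e 4, \<lambda>e. Poly_Mapping.lookup e 3]"

lemma wf_mon_order: "wf mon_order"
  by (simp add: mon_order_def)

lemma mon_order_add: "(u, u') \<in> mon_order \<Longrightarrow> (v + u, v + u') \<in> mon_order"
  by (auto simp: mon_order_def lookup_add)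

definition leading_exponent :: "'a::comm_ring_1 cox_ring \<Rightarrow> (4 \<Rightarrow>\<^sub>0 nat) \<Rightarrow> bool" where
  "leading_exponent g u \<longleftrightarrow> Poly_Mapping.lookup g u = 1 \<and>
     (\<forall>e\<in>Poly_Mapping.keys g. e \<noteq> u \<longrightarrow> (e, u) \<in> mon_order)"

text \<open>A term divisible by a leading monomial is traded for smaller terms of the same degree,
  which stops because \<open>mon_order\<close> is well founded. Remainders add up, so single terms
  suffice. \<open>L\<close> pairs each divisor with its leading exponent.\<close>

lemma division:
  fixes L :: "('a::comm_ring_1 cox_ring \<times> (4 \<Rightarrow>\<^sub>0 nat)) set"
  assumes lead: "\<And>g u. (g, u) \<in> L \<Longrightarrow> leading_exponent g u"
    and hom: "\<And>g u. (g, u) \<in> L \<Longrightarrow> homogeneous l g"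
    and f: "\<And>e. e \<in> Poly_Mapping.keys f \<Longrightarrow> mon_deg l e = d"
  obtains r where "f - r \<in> ideal_gen (fst ` L)"
    "\<And>e. e \<in> Poly_Mapping.keys r \<Longrightarrow> mon_deg l e = d"
    "\<And>e g u v. e \<in> Poly_Mapping.keys r \<Longrightarrow> (g, u) \<in> L \<Longrightarrow> e \<noteq> u + v"
proof -
  define R where "R = {e. mon_deg l e = d \<and> (\<forall>(g, u)\<in>L. \<forall>v. e \<noteq> u + v)}"
  define good where "good f \<longleftrightarrow> (\<exists>r. f - r \<in> ideal_gen (fst ` L) \<and> Poly_Mapping.keys r \<subseteq> R)" for f
  have good_0: "good 0"
    unfolding good_def by (intro exI[of _ 0]) (auto intro: ideal_gen_zero)
  have good_add: "good (f + g)" if "good f" "good g" for f g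
  proof -
    obtain r s where "f - r \<in> ideal_gen (fst ` L)" "Poly_Mapping.keys r \<subseteq> R"
      "g - s \<in> ideal_gen (fst ` L)" "Poly_Mapping.keys s \<subseteq> R"
      using \<open>good f\<close> \<open>good g\<close> unfolding good_def by blast
    then have "f + g - (r + s) \<in> ideal_gen (fst ` L)" "Poly_Mapping.keys (r + s) \<subseteq> R"
      using ideal_gen_add[of "f - r" "fst ` L" "g - s"] by (simp_all add: algebra_simps keys_add_subset)
    then show ?thesis
      unfolding good_def by blast
  qed
  have good_single: "good (Poly_Mapping.single e c)" if "mon_deg l e = d" for e c
    using wf_mon_order that
  proof (induction e arbitrary: c rule: wf_induct_rule)
    case (less e)
    show ?case
    proof (cases "e \<in> R")
      case True
      then show ?thesis
        unfolding good_def by (intro exI[of _ "Poly_Mapping.single e c"]) (auto intro: ideal_gen_zero)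
    next
      case False
      then obtain g v u\<^sub>0 where g: "(g, u\<^sub>0) \<in> L" and e: "e = v + u\<^sub>0"
        using less.prems by (auto simp: R_def add.commute)
      define h where "h = g - Poly_Mapping.single (u\<^sub>0) 1"
      have h: "e' \<in> Poly_Mapping.keys g" "e' \<noteq> u\<^sub>0" if "e' \<in> Poly_Mapping.keys h" for e'
        using that lead[OF g] unfolding h_def leading_exponent_def
        by (auto simp: in_keys_iff lookup_minus lookup_single when_def split: if_splits)
      \<comment> \<open>This is what is left of the term \<open>Poly_Mapping.single e c\<close>
        after subtracting \<open>Poly_Mapping.single v c * g\<close>. All its exponents lie below
        \<open>e\<close> and have the degree of \<open>e\<close>, so the induction hypothesis
        applies to each of its terms.\<close>
      define s where "s = Poly_Mapping.single v (- c) * h"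
      have "good s"
      proof (induction s rule: poly_mapping_induct_keys)
        case (single e')
        then obtain u where "u \<in> Poly_Mapping.keys h" "e' = v + u"
          using keys_mult[of "Poly_Mapping.single v (- c)" h] unfolding s_def
          by (auto split: if_splits)
        then have "(e', e) \<in> mon_order"
          using h lead[OF g] by (auto simp: leading_exponent_def e mon_order_add)
        moreover have "mon_deg l e' = mon_deg l e"
          using hom[OF g] lead[OF g] h(1)[OF \<open>u \<in> Poly_Mapping.keys h\<close>] \<open>e' = v + u\<close>
          by (auto simp: homogeneous_def leading_exponent_def e mon_deg_add in_keys_iff)
        ultimately show ?case
          using less by auto
      qed (fact good_0 good_add)+
      then obtain r where r: "s - r \<in> ideal_gen (fst ` L)" "Poly_Mapping.keys r \<subseteq> R"
        unfolding good_def by blast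
      have "Poly_Mapping.single v c * (Poly_Mapping.single (u\<^sub>0) 1 + h)
          = Poly_Mapping.single e c + Poly_Mapping.single v c * h"
        by (simp add: distrib_left mult_single e)
      then have "Poly_Mapping.single v c * g
          = Poly_Mapping.single e c + Poly_Mapping.single v c * h"
        by (simp add: h_def)
      moreover have "s = - (Poly_Mapping.single v c * h)"
        by (simp add: s_def single_uminus)
      ultimately have "Poly_Mapping.single e c - r = (s - r) + Poly_Mapping.single v c * g"
        by simp
      moreover have "g \<in> ideal_gen (fst ` L)"
        using g by (force intro: ideal_gen_base)
      ultimately have "Poly_Mapping.single e c - r \<in> ideal_gen (fst ` L)"
        using r(1) by (simp only: ideal_gen_add ideal_gen_mult_left)
      then show ?thesis
        using r(2) unfolding good_def by blast
    qed
  qed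
  have "good f"
    by (induction f rule: poly_mapping_induct_keys) (use good_0 good_add good_single f in auto)
  then show ?thesis
    using that unfolding good_def R_def by fast
qed

section \<open>Forms over a finite field\<close>

text \<open>Multiplication by \<open>x\<close> permutes the nonzero elements, so it preserves their
  product, which can then be cancelled.\<close>

lemma power_card_minus_1:
  fixes x :: "'a::{field, finite}"
  assumes "x \<noteq> 0"
  shows "x ^ (CARD('a) - 1) = 1"
proof -
  have "(\<Prod>y\<in>UNIV-{0}. x * y) = x ^ (CARD('a) - 1) * \<Prod>(UNIV-{0})"
    by (simp add: prod.distrib)
  moreover have "(\<Prod>y\<in>UNIV-{0}. x * y) = (\<Prod>y\<in>UNIV-{0}. y)"
    by (rule prod.reindex_bij_witness[of _ "\<lambda>y. y / x" "\<lambda>y. x * y"]) (use assms in auto)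
  ultimately show ?thesis
    by simp
qed

lemma card_field_ge_2: "2 \<le> CARD('a::{field, finite})"
  using card_mono[of "UNIV :: 'a set" "{0, 1}"] by simp

text \<open>A polynomial of degree below \<open>CARD('a)\<close> with every field element as a root
  is zero. The index set will consist of monomials in four variables, on which \<open>\<phi>\<close>
  need not be injective; hence a coefficient is a sum over a fibre of \<open>\<phi>\<close>.\<close>

lemma univariate_vanishing:
  fixes w :: "'e \<Rightarrow> 'a::{field, finite}"
  assumes "finite K" and "\<And>e. e \<in> K \<Longrightarrow> \<phi> e < CARD('a)"
    and "\<And>x. (\<Sum>e\<in>K. w e * x ^ \<phi> e) = 0"
  shows "(\<Sum>e\<in>{e\<in>K. \<phi> e = n}. w e) = 0"
proof -
  define p where "p = (\<Sum>e\<in>K. Polynomial.monom (w e) (\<phi> e))"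
  have "degree p \<le> CARD('a) - 1"
    unfolding p_def using assms(2)
    by (intro degree_sum_le assms(1) order.trans[OF degree_monom_le]) fastforce
  then have "degree p < CARD('a)"
    using card_field_ge_2[where ?'a = 'a] by linarith
  moreover have "poly p x = 0" for x
    using assms(3) by (simp add: p_def poly_sum poly_monom)
  ultimately have "p = 0"
    by (intro poly_eqI_degree[of UNIV]) auto
  then have "0 = coeff p n"
    by simp
  also have "\<dots> = (\<Sum>e\<in>K. if \<phi> e = n then w e else 0)"
    by (simp add: p_def coeff_sum)
  also have "\<dots> = (\<Sum>e\<in>{e\<in>K. \<phi> e = n}. w e)"
    using assms(1) by (rule sum.inter_filter[symmetric])
  finally show ?thesis
    by simp
qed

text \<open>Only the pure power of \<open>x\<close> may have a large exponent. The point (1, 0)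
  shows that its coefficient is zero; what remains has exponents below \<open>CARD('a)\<close> and
  is handled by setting \<open>y = 1\<close>.\<close>

lemma binary_vanishing:
  fixes w :: "'e \<Rightarrow> 'a::{field, finite}"
  assumes "finite K" and "\<And>e. e \<in> K \<Longrightarrow> \<phi> e + \<psi> e = b"
    and small: "\<And>e. e \<in> K \<Longrightarrow> \<phi> e < CARD('a) \<or> \<psi> e = 0"
    and vanish: "\<And>x y. x \<noteq> 0 \<or> y \<noteq> 0 \<Longrightarrow> (\<Sum>e\<in>K. w e * x ^ \<phi> e * y ^ \<psi> e) = 0"
  shows "(\<Sum>e\<in>{e\<in>K. \<phi> e = n}. w e) = 0"
proof -
  have top: "(\<Sum>e\<in>{e\<in>K. \<phi> e = b}. w e) = 0"
  proof -
    have "(\<Sum>e\<in>{e\<in>K. \<phi> e = b}. w e) = (\<Sum>e\<in>K. if \<phi> e = b then w e else 0)"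
      using assms(1) by (rule sum.inter_filter)
    \<comment> \<open>Since \<open>0 ^ 0 = 1\<close>, exactly the terms with
      \<open>\<psi> e = 0\<close>, that is \<open>\<phi> e = b\<close>, survive at (1, 0).\<close>
    also have "\<dots> = (\<Sum>e\<in>K. w e * 1 ^ \<phi> e * 0 ^ \<psi> e)"
      by (rule sum.cong) (use assms(2) in \<open>force simp: power_0_left\<close>)+
    finally show ?thesis
      using vanish[of 1 0] by simp
  qed
  show ?thesis
  proof (cases "n = b")
    case False
    let ?K = "{e\<in>K. \<phi> e \<noteq> b}"
    have "(\<Sum>e\<in>?K. w e * x ^ \<phi> e) = 0" for x
    proof -
      have "0 = (\<Sum>e\<in>K. w e * x ^ \<phi> e)"
        using vanish[of x 1] by simp
      also have "\<dots> = (\<Sum>e\<in>{e\<in>K. \<phi> e = b}. w e * x ^ \<phi> e) + (\<Sum>e\<in>?K. w e * x ^ \<phi> e)"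
        using assms(1) by (subst sum.union_disjoint[symmetric]) (auto intro!: sum.cong)
      also have "(\<Sum>e\<in>{e\<in>K. \<phi> e = b}. w e * x ^ \<phi> e) = (\<Sum>e\<in>{e\<in>K. \<phi> e = b}. w e) * x ^ b"
        by (simp add: sum_distrib_right)
      finally show ?thesis
        using top by simp
    qed
    moreover have "\<phi> e < CARD('a)" if "e \<in> ?K" for e
      using that small[of e] assms(2)[of e] by auto
    ultimately have "(\<Sum>e\<in>{e\<in>?K. \<phi> e = n}. w e) = 0"
      using assms(1) by (intro univariate_vanishing) auto
    moreover have "{e\<in>?K. \<phi> e = n} = {e\<in>K. \<phi> e = n}"
      using False by auto
    ultimately show ?thesis
      by simp
  qed (use top in simp)
qed


section \<open>Exponent vectors on four variables\<close>

definition expo :: "nat \<Rightarrow> nat \<Rightarrow> nat \<Rightarrow> nat \<Rightarrow> 4 \<Rightarrow>\<^sub>0 nat" where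
  "expo a b c d = Poly_Mapping.single 1 a + Poly_Mapping.single 2 b
     + Poly_Mapping.single 3 c + Poly_Mapping.single 4 d"

lemma lookup_expo [simp]:
  "Poly_Mapping.lookup (expo a b c d) 1 = a"
  "Poly_Mapping.lookup (expo a b c d) 2 = b"
  "Poly_Mapping.lookup (expo a b c d) 3 = c"
  "Poly_Mapping.lookup (expo a b c d) 4 = d"
  by (simp_all add: expo_def lookup_add lookup_single)

lemma expo_eqI:
  assumes "Poly_Mapping.lookup e 1 = a" "Poly_Mapping.lookup e 2 = b"
    "Poly_Mapping.lookup e 3 = c" "Poly_Mapping.lookup e 4 = d"
  shows "e = expo a b c d"
proof (rule poly_mapping_eqI)
  fix i :: 4
  show "Poly_Mapping.lookup e i = Poly_Mapping.lookup (expo a b c d) i"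
    using exhaust_4[of i] assms by auto
qed

lemma exponent_eqI:
  assumes "Poly_Mapping.lookup e 1 = Poly_Mapping.lookup e' 1"
    "Poly_Mapping.lookup e 2 = Poly_Mapping.lookup e' 2"
    "Poly_Mapping.lookup e 3 = Poly_Mapping.lookup e' 3"
    "Poly_Mapping.lookup e 4 = Poly_Mapping.lookup e' 4"
  shows "e = (e' :: 4 \<Rightarrow>\<^sub>0 nat)"
  using expo_eqI[OF assms] expo_eqI[OF refl refl refl refl, of e'] by simp

lemma expo_inject [simp]:
  "expo a b c d = expo a' b' c' d' \<longleftrightarrow> a = a' \<and> b = b' \<and> c = c' \<and> d = d'"
  by (metis lookup_expo)

lemma expo_not_divides:
  assumes "\<And>v. e \<noteq> expo a b c d + v"
  shows "Poly_Mapping.lookup e 1 < a \<or> Poly_Mapping.lookup e 2 < b \<or>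
    Poly_Mapping.lookup e 3 < c \<or> Poly_Mapping.lookup e 4 < d"
proof (rule ccontr)
  assume "\<not> ?thesis"
  \<comment> \<open>With no exponent of \<open>e\<close> too small, the truncated subtraction is
    exact and yields the cofactor.\<close>
  then have "e = expo a b c d + (e - expo a b c d)"
    by (intro exponent_eqI) (simp_all add: lookup_add lookup_minus)
  then show False
    using assms by blast
qed

lemma mon_deg_eq:
  "mon_deg l e =
    (int (Poly_Mapping.lookup e 1 + Poly_Mapping.lookup e 3 + l * Poly_Mapping.lookup e 4),
     int (Poly_Mapping.lookup e 2 + Poly_Mapping.lookup e 4))"
  by (simp add: mon_deg_def var_deg_def sum_4)

lemma prod_4: "prod f (UNIV::4 set) = f 1 * f 2 * f 3 * f 4"
  unfolding UNIV_4 by (simp add: mult.assoc)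

definition monomial :: "nat \<Rightarrow> nat \<Rightarrow> nat \<Rightarrow> nat \<Rightarrow> 'a::comm_ring_1 cox_ring" where
  "monomial a b c d = Poly_Mapping.single (expo a b c d) 1"

lemma Var_eq_monomial:
  "Var 1 = monomial 1 0 0 0" "Var 2 = monomial 0 1 0 0"
  "Var 3 = monomial 0 0 1 0" "Var 4 = monomial 0 0 0 1"
  by (simp_all add: Var_def monomial_def expo_def)

lemma monomial_mult:
  "monomial a b c d * monomial a' b' c' d' = monomial (a + a') (b + b') (c + c') (d + d')"
proof -
  have "expo a b c d + expo a' b' c' d' = expo (a + a') (b + b') (c + c') (d + d')"
    by (rule expo_eqI) (simp_all add: lookup_add)
  then show ?thesis
    by (simp add: monomial_def mult_single)
qed

lemma monomial_power: "monomial a b c d ^ n = monomial (n * a) (n * b) (n * c) (n * d)"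
proof (induction n)
  case 0
  have "expo 0 0 0 0 = 0"
    by (simp add: expo_def)
  then show ?case
    by (simp add: monomial_def)
qed (simp add: monomial_mult)

lemma keys_monomial_subset: "expo a b c d \<in> A \<Longrightarrow> Poly_Mapping.keys (monomial a b c d) \<subseteq> A"
  by (simp add: monomial_def)

lemma lookup_monomial:
  "Poly_Mapping.lookup (monomial a b c d) (expo a' b' c' d') =
    (if a = a' \<and> b = b' \<and> c = c' \<and> d = d' then 1 else 0)"
  by (simp add: monomial_def lookup_single when_def)


section \<open>The generators\<close>

lemmas monomial_simps = Var_eq_monomial monomial_mult monomial_power

context
  fixes l q :: nat
  assumes q: "2 \<le> q"
begin

text \<open>In this and the next four expansions the leading monomial comes first.\<close>

lemma F1_eq: "F1 q = monomial 1 0 q 0 - monomial q 0 1 0"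
  using q by (simp add: F1_def monomial_simps right_diff_distrib)

lemma F2_eq: "F2 l q = monomial 1 1 0 q - monomial ((q - 1) * l + 1) q 0 1"
  using q by (simp add: F2_def monomial_simps right_diff_distrib)

lemma F3_eq: "F3 l q = monomial 0 1 1 q - monomial 0 q ((q - 1) * l + 1) 1"
  using q by (simp add: F3_def monomial_simps right_diff_distrib)

lemma F4_eq: "F4 l q = monomial 0 1 0 q - monomial 0 q ((q - 1) * l) 1
    + monomial ((q - 1) * (l - 1)) q (q - 1) 1 - monomial ((q - 1) * l) q 0 1"
  by (simp add: F4_def monomial_simps)

lemma F4'_eq: "F4' q = monomial 0 1 0 (2 * q - 1) - monomial 0 (2 * q - 1) (2 * (q - 1)) 1
    + monomial (q - 1) (2 * q - 1) (q - 1) 1 - monomial (2 * (q - 1)) (2 * q - 1) 0 1"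
  by (simp add: F4'_def monomial_simps)

text \<open>Supports are only bounded from above, because terms may cancel: for \<open>l = 1\<close>
  the two middle terms of \<open>F4\<close> do.\<close>

lemma keys_F1: "Poly_Mapping.keys (F1 q) \<subseteq> {expo 1 0 q 0, expo q 0 1 0}"
  unfolding F1_eq by (intro keys_diff_subset keys_monomial_subset) simp_all

lemma keys_F2: "Poly_Mapping.keys (F2 l q) \<subseteq> {expo 1 1 0 q, expo ((q - 1) * l + 1) q 0 1}"
  unfolding F2_eq by (intro keys_diff_subset keys_monomial_subset) simp_all

lemma keys_F3: "Poly_Mapping.keys (F3 l q) \<subseteq> {expo 0 1 1 q, expo 0 q ((q - 1) * l + 1) 1}"
  unfolding F3_eq by (intro keys_diff_subset keys_monomial_subset) simp_all

lemma keys_F4: "Poly_Mapping.keys (F4 l q) \<subseteq> {expo 0 1 0 q, expo 0 q ((q - 1) * l) 1,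
    expo ((q - 1) * (l - 1)) q (q - 1) 1, expo ((q - 1) * l) q 0 1}"
  unfolding F4_eq by (intro keys_add_subset keys_diff_subset keys_monomial_subset) simp_all

lemma keys_F4': "Poly_Mapping.keys (F4' q) \<subseteq> {expo 0 1 0 (2 * q - 1),
    expo 0 (2 * q - 1) (2 * (q - 1)) 1, expo (q - 1) (2 * q - 1) (q - 1) 1,
    expo (2 * (q - 1)) (2 * q - 1) 0 1}"
  unfolding F4'_eq by (intro keys_add_subset keys_diff_subset keys_monomial_subset) simp_all

lemma lookup_lead:
  "Poly_Mapping.lookup (F1 q) (expo 1 0 q 0) = 1"
  "Poly_Mapping.lookup (F2 l q) (expo 1 1 0 q) = 1"
  "Poly_Mapping.lookup (F3 l q) (expo 0 1 1 q) = 1"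
  "Poly_Mapping.lookup (F4 l q) (expo 0 1 0 q) = 1"
  "Poly_Mapping.lookup (F4' q) (expo 0 1 0 (2 * q - 1)) = 1"
  using q by (simp_all add: F1_eq F2_eq F3_eq F4_eq F4'_eq lookup_add lookup_minus lookup_monomial)

lemma mon_deg_F1: "e \<in> Poly_Mapping.keys (F1 q) \<Longrightarrow> mon_deg l e = mon_deg l (expo 1 0 q 0)"
  using keys_F1 by (auto simp: mon_deg_eq)

lemma mon_deg_F2: "e \<in> Poly_Mapping.keys (F2 l q) \<Longrightarrow> mon_deg l e = mon_deg l (expo 1 1 0 q)"
  using q keys_F2 by (auto simp: mon_deg_eq algebra_simps of_nat_diff)

lemma mon_deg_F3: "e \<in> Poly_Mapping.keys (F3 l q) \<Longrightarrow> mon_deg l e = mon_deg l (expo 0 1 1 q)"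
  using q keys_F3 by (auto simp: mon_deg_eq algebra_simps of_nat_diff)

lemma mon_deg_F4:
  assumes "0 < l" "e \<in> Poly_Mapping.keys (F4 l q)"
  shows "mon_deg l e = mon_deg l (expo 0 1 0 q)"
proof -
  \<comment> \<open>Writing \<open>q\<close> and \<open>l\<close> as successors removes the
    truncated subtractions from the exponents.\<close>
  obtain p where p: "q = Suc p"
    using q by (cases q) auto
  obtain k where k: "l = Suc k"
    using assms(1) by (cases l) auto
  show ?thesis
    using keys_F4 assms(2) unfolding p k by (auto simp: mon_deg_eq algebra_simps)
qed

lemma mon_deg_F4':
  "e \<in> Poly_Mapping.keys (F4' q) \<Longrightarrow> mon_deg 1 e = mon_deg 1 (expo 0 1 0 (2 * q - 1))"
  using q keys_F4' by (auto simp: mon_deg_eq algebra_simps of_nat_diff)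

lemma leading_exponent_F1: "leading_exponent (F1 q) (expo 1 0 q 0)"
  using q lookup_lead(1) by (auto simp: leading_exponent_def mon_order_def dest!: subsetD[OF keys_F1])

lemma leading_exponent_F2: "leading_exponent (F2 l q) (expo 1 1 0 q)"
  using q lookup_lead(2) by (auto simp: leading_exponent_def mon_order_def dest!: subsetD[OF keys_F2])

lemma leading_exponent_F3: "leading_exponent (F3 l q) (expo 0 1 1 q)"
  using q lookup_lead(3) by (auto simp: leading_exponent_def mon_order_def dest!: subsetD[OF keys_F3])

lemma leading_exponent_F4: "leading_exponent (F4 l q) (expo 0 1 0 q)"
  using q lookup_lead(4) by (auto simp: leading_exponent_def mon_order_def dest!: subsetD[OF keys_F4])

lemma leading_exponent_F4': "leading_exponent (F4' q) (expo 0 1 0 (2 * q - 1))"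
  using q lookup_lead(5) by (auto simp: leading_exponent_def mon_order_def dest!: subsetD[OF keys_F4'])

lemma homogeneous_F1: "homogeneous l (F1 q)"
  unfolding homogeneous_def using mon_deg_F1 by blast

lemma homogeneous_F2: "homogeneous l (F2 l q)"
  unfolding homogeneous_def using mon_deg_F2 by blast

lemma homogeneous_F3: "homogeneous l (F3 l q)"
  unfolding homogeneous_def using mon_deg_F3 by blast

lemma homogeneous_F4: "0 < l \<Longrightarrow> homogeneous l (F4 l q)"
  unfolding homogeneous_def using mon_deg_F4 by blast

lemma homogeneous_F4': "homogeneous 1 (F4' q)"
  unfolding homogeneous_def using mon_deg_F4' by blast

section \<open>Minimality: no generator lies in the ideal of the others\<close>

text \<open>These bounds name variables, or large exponents, shared by all monomials of a generator;
  they keep such monomials from dividing the leading monomials of the other generators.\<close>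

lemma keys_F1_ge:
  "e \<in> Poly_Mapping.keys (F1 q) \<Longrightarrow> 0 < Poly_Mapping.lookup e 1 \<and> 0 < Poly_Mapping.lookup e 3"
  using q keys_F1 by auto

lemma keys_F2_ge:
  "e \<in> Poly_Mapping.keys (F2 l q) \<Longrightarrow> 0 < Poly_Mapping.lookup e 1 \<and> 0 < Poly_Mapping.lookup e 4"
  using q keys_F2 by auto

lemma keys_F3_ge:
  "e \<in> Poly_Mapping.keys (F3 l q) \<Longrightarrow> 0 < Poly_Mapping.lookup e 3 \<and> 0 < Poly_Mapping.lookup e 4"
  using q keys_F3 by auto

lemma keys_F4_ge: "e \<in> Poly_Mapping.keys (F4 l q) \<Longrightarrow> 0 < Poly_Mapping.lookup e 4"
  using q keys_F4 by auto

lemma keys_F4'_ge: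
  "e \<in> Poly_Mapping.keys (F4' q) \<Longrightarrow>
    0 < Poly_Mapping.lookup e 4 \<and> (1 < Poly_Mapping.lookup e 2 \<or> q < Poly_Mapping.lookup e 4)"
  using q by (auto dest!: subsetD[OF keys_F4'])

lemma notin_ideal_gen:
  fixes f :: "'a::comm_ring_1 cox_ring"
  assumes "Poly_Mapping.lookup f m = 1"
    and "\<And>g e. g \<in> A \<Longrightarrow> e \<in> Poly_Mapping.keys g \<Longrightarrow>
           \<exists>i. Poly_Mapping.lookup m i < Poly_Mapping.lookup e i"
  shows "f \<notin> ideal_gen A"
  using lookup_ideal_gen_eq_0[of f A m] assms by auto

text \<open>The leading monomial of \<open>F1\<close> is free of \<open>x4\<close>, which divides
  every monomial of the other generators. The set allowed for \<open>A\<close> serves both cases of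
  the theorem.\<close>

lemma F1_notin_ideal_gen:
  assumes "A \<subseteq> {F2 l q, F3 l q, F4 l q, F4' q}"
  shows "F1 q \<notin> ideal_gen A"
proof (rule notin_ideal_gen[OF lookup_lead(1)])
  fix g e assume g: "g \<in> A" "e \<in> Poly_Mapping.keys g"
  then have "g = F2 l q \<or> g = F3 l q \<or> g = F4 l q \<or> g = F4' q"
    using assms by blast
  then have "0 < Poly_Mapping.lookup e 4"
    using g(2) by (auto dest: keys_F2_ge keys_F3_ge keys_F4_ge keys_F4'_ge)
  then show "\<exists>i. Poly_Mapping.lookup (expo 1 0 q 0) i < Poly_Mapping.lookup e i"
    by (metis lookup_expo(4))
qed

text \<open>The leading monomial of \<open>F2\<close> is free of \<open>x3\<close>, which excludes
  \<open>F1\<close> and \<open>F3\<close>; its exponents 1 of \<open>x2\<close> and \<open>q\<close>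
  of \<open>x4\<close> are too small for any monomial of \<open>F4'\<close>.\<close>

lemma F2_notin_ideal_gen:
  assumes "A \<subseteq> {F1 q, F3 l q, F4' q}"
  shows "F2 l q \<notin> ideal_gen A"
proof (rule notin_ideal_gen[OF lookup_lead(2)])
  fix g e assume g: "g \<in> A" "e \<in> Poly_Mapping.keys g"
  then have "g = F1 q \<or> g = F3 l q \<or> g = F4' q"
    using assms by blast
  then have "0 < Poly_Mapping.lookup e 3 \<or> 1 < Poly_Mapping.lookup e 2 \<or> q < Poly_Mapping.lookup e 4"
    using g(2) by (auto dest: keys_F1_ge keys_F3_ge keys_F4'_ge)
  then show "\<exists>i. Poly_Mapping.lookup (expo 1 1 0 q) i < Poly_Mapping.lookup e i"
    by (metis lookup_expo)
qed

text \<open>As for \<open>F2\<close>, with \<open>x1\<close> and \<open>x3\<close>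
  exchanged.\<close>

lemma F3_notin_ideal_gen:
  assumes "A \<subseteq> {F1 q, F2 l q, F4' q}"
  shows "F3 l q \<notin> ideal_gen A"
proof (rule notin_ideal_gen[OF lookup_lead(3)])
  fix g e assume g: "g \<in> A" "e \<in> Poly_Mapping.keys g"
  then have "g = F1 q \<or> g = F2 l q \<or> g = F4' q"
    using assms by blast
  then have "0 < Poly_Mapping.lookup e 1 \<or> 1 < Poly_Mapping.lookup e 2 \<or> q < Poly_Mapping.lookup e 4"
    using g(2) by (auto dest: keys_F1_ge keys_F2_ge keys_F4'_ge)
  then show "\<exists>i. Poly_Mapping.lookup (expo 0 1 1 q) i < Poly_Mapping.lookup e i"
    by (metis lookup_expo)
qed

lemma F4_notin_ideal_gen:
  assumes "A \<subseteq> {F1 q}"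
  shows "F4 l q \<notin> ideal_gen A"
proof (rule notin_ideal_gen[OF lookup_lead(4)])
  fix g e assume g: "g \<in> A" "e \<in> Poly_Mapping.keys g"
  then have "0 < Poly_Mapping.lookup e 1"
    using assms by (auto dest!: subsetD dest: keys_F1_ge)
  then show "\<exists>i. Poly_Mapping.lookup (expo 0 1 0 q) i < Poly_Mapping.lookup e i"
    by (metis lookup_expo(1))
qed

text \<open>The leading monomial of \<open>F4'\<close> contains neither \<open>x1\<close> nor
  \<open>x3\<close>, while each monomial of the other three contains at least one of them.\<close>

lemma F4'_notin_ideal_gen:
  assumes "A \<subseteq> {F1 q, F2 l q, F3 l q}"
  shows "F4' q \<notin> ideal_gen A"
proof (rule notin_ideal_gen[OF lookup_lead(5)])
  fix g e assume g: "g \<in> A" "e \<in> Poly_Mapping.keys g"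
  then have "g = F1 q \<or> g = F2 l q \<or> g = F3 l q"
    using assms by blast
  then have "0 < Poly_Mapping.lookup e 1 \<or> 0 < Poly_Mapping.lookup e 3"
    using g(2) by (auto dest: keys_F1_ge keys_F2_ge keys_F3_ge)
  then show "\<exists>i. Poly_Mapping.lookup (expo 0 1 0 (2 * q - 1)) i < Poly_Mapping.lookup e i"
    by (metis lookup_expo)
qed

end


section \<open>Vanishing at the rational points\<close>

definition vanishing :: "'a::field cox_ring \<Rightarrow> bool" where
  "vanishing f \<longleftrightarrow> (\<forall>P. (P 1 \<noteq> 0 \<or> P 3 \<noteq> 0) \<and> (P 2 \<noteq> 0 \<or> P 4 \<noteq> 0) \<longrightarrow> eval_at f P = 0)"

text \<open>If one coordinate of each pair is nonzero, the product of the two corresponding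
  variables lies in both ideals and does not vanish at \<open>P\<close>.\<close>

lemma notin_zero_locus_irrelevant_ideal:
  fixes P :: "4 \<Rightarrow> 'a::field"
  shows "P \<notin> zero_locus irrelevant_ideal \<longleftrightarrow> (P 1 \<noteq> 0 \<or> P 3 \<noteq> 0) \<and> (P 2 \<noteq> 0 \<or> P 4 \<noteq> 0)"
proof
  assume "P \<notin> zero_locus irrelevant_ideal"
  then obtain f where f: "f \<in> ideal_gen {Var 1, Var 3}" "f \<in> ideal_gen {Var 2, Var 4}"
    "eval_at f P \<noteq> 0"
    by (auto simp: zero_locus_def irrelevant_ideal_def)
  have "eval_at f P = 0" if "P 1 = 0" "P 3 = 0"
    using f(1) by (rule eval_at_ideal_gen) (use that in auto)
  moreover have "eval_at f P = 0" if "P 2 = 0" "P 4 = 0"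
    using f(2) by (rule eval_at_ideal_gen) (use that in auto)
  ultimately show "(P 1 \<noteq> 0 \<or> P 3 \<noteq> 0) \<and> (P 2 \<noteq> 0 \<or> P 4 \<noteq> 0)"
    using f(3) by blast
next
  assume "(P 1 \<noteq> 0 \<or> P 3 \<noteq> 0) \<and> (P 2 \<noteq> 0 \<or> P 4 \<noteq> 0)"
  then obtain i j where ij: "i \<in> {1, 3}" "j \<in> {2, 4}" "P i \<noteq> 0" "P j \<noteq> 0"
    by blast
  have "Var i * Var j \<in> ideal_gen {Var 1, Var 3}"
    by (rule ideal_gen_mult_right, rule ideal_gen_base) (use ij in auto)
  moreover have "Var i * Var j \<in> ideal_gen {Var 2, Var 4}"
    by (rule ideal_gen_mult_left, rule ideal_gen_base) (use ij in auto)
  ultimately have "Var i * Var j \<in> irrelevant_ideal"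
    by (simp add: irrelevant_ideal_def)
  moreover have "eval_at (Var i * Var j) P \<noteq> 0"
    using ij by simp
  ultimately show "P \<notin> zero_locus irrelevant_ideal"
    unfolding zero_locus_def by blast
qed

text \<open>For \<open>P\<close> outside the zero locus, \<open>torus_orbit l P\<close> belongs to
  \<open>hirzebruch_points l\<close> by definition, so the ideal is described by evaluation over the
  ground field.\<close>

lemma vanishing_ideal_hirzebruch_points:
  "vanishing_ideal l (hirzebruch_points l) = ideal_gen {f. homogeneous l f \<and> vanishing f}"
proof -
  have "P \<notin> zero_locus irrelevant_ideal \<and> torus_orbit l P \<in> hirzebruch_points l \<longleftrightarrow>
    (P 1 \<noteq> 0 \<or> P 3 \<noteq> 0) \<and> (P 2 \<noteq> 0 \<or> P 4 \<noteq> 0)" for P :: "4 \<Rightarrow> 'a"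
    unfolding hirzebruch_points_def using notin_zero_locus_irrelevant_ideal[of P] by blast
  then show ?thesis
    unfolding vanishing_ideal_def vanishing_def by presburger
qed

text \<open>The factors are ordered for \<open>binary_vanishing\<close> in \<open>x4\<close> and
  \<open>x2\<close>, the powers of \<open>x1\<close> and \<open>x3\<close> being absorbed into the
  weights.\<close>

lemma vanishing_sum_eq_0:
  assumes "vanishing r" "x1 \<noteq> 0 \<or> x3 \<noteq> 0" "x2 \<noteq> 0 \<or> x4 \<noteq> 0"
  shows "(\<Sum>e\<in>Poly_Mapping.keys r. Poly_Mapping.lookup r e *
    x1 ^ Poly_Mapping.lookup e 1 * x3 ^ Poly_Mapping.lookup e 3 *
    x4 ^ Poly_Mapping.lookup e 4 * x2 ^ Poly_Mapping.lookup e 2) = 0"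
proof -
  define P :: "4 \<Rightarrow> 'a" where
    "P i = (if i = 1 then x1 else if i = 2 then x2 else if i = 3 then x3 else x4)" for i
  have P: "P 1 = x1" "P 2 = x2" "P 3 = x3" "P 4 = x4"
    by (simp_all add: P_def)
  have "eval_at r P = 0"
    using assms unfolding vanishing_def by (simp add: P)
  then show ?thesis
    by (simp add: eval_at_def prod_4 P mult_ac)
qed

section \<open>Reduced homogeneous polynomials that vanish are zero\<close>

lemma mon_deg_eq_iff:
  "mon_deg l e = mon_deg l e' \<longleftrightarrow>
    Poly_Mapping.lookup e 1 + Poly_Mapping.lookup e 3 + l * Poly_Mapping.lookup e 4 =
      Poly_Mapping.lookup e' 1 + Poly_Mapping.lookup e' 3 + l * Poly_Mapping.lookup e' 4 \<and>
    Poly_Mapping.lookup e 2 + Poly_Mapping.lookup e 4 =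
      Poly_Mapping.lookup e' 2 + Poly_Mapping.lookup e' 4"
  by (simp only: mon_deg_eq prod.inject of_nat_eq_iff)

text \<open>\<open>binary_vanishing\<close> is used twice: in \<open>x4\<close> and
  \<open>x2\<close> with \<open>x1\<close> and \<open>x3\<close> fixed, and then in
  \<open>x3\<close> and \<open>x1\<close> on the slice of one exponent of \<open>x4\<close>. Fixing
  the degree and the exponents of \<open>x4\<close> and \<open>x3\<close> leaves the single monomial
  \<open>e0\<close>, whose coefficient must therefore be zero.\<close>

lemma reduced_vanishing_eq_0:
  fixes r :: "'a::{field, finite} cox_ring"
  assumes vanishing: "vanishing r"
    and deg: "\<And>e. e \<in> Poly_Mapping.keys r \<Longrightarrow> mon_deg l e = d"
    and red13: "\<And>e. e \<in> Poly_Mapping.keys r \<Longrightarrow>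
      Poly_Mapping.lookup e 3 < CARD('a) \<or> Poly_Mapping.lookup e 1 = 0"
    and red24: "\<And>e. e \<in> Poly_Mapping.keys r \<Longrightarrow>
      Poly_Mapping.lookup e 4 < CARD('a) \<or> Poly_Mapping.lookup e 2 = 0"
  shows "r = 0"
proof (rule ccontr)
  assume "r \<noteq> 0"
  then obtain e0 where e0: "e0 \<in> Poly_Mapping.keys r"
    by (metis ex_in_conv keys_eq_empty)
  define n where "n = Poly_Mapping.lookup e0 4"
  let ?K = "Poly_Mapping.keys r"
  let ?Kn = "{e \<in> ?K. Poly_Mapping.lookup e 4 = n}"
  have deg': "Poly_Mapping.lookup e 1 + Poly_Mapping.lookup e 3 + l * Poly_Mapping.lookup e 4 =
      Poly_Mapping.lookup e0 1 + Poly_Mapping.lookup e0 3 + l * n"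
    "Poly_Mapping.lookup e 2 + Poly_Mapping.lookup e 4 = Poly_Mapping.lookup e0 2 + n"
    if "e \<in> ?K" for e
    using deg[OF that] deg[OF e0] mon_deg_eq_iff[of l e e0] by (simp_all add: n_def)
  have slice: "(\<Sum>e\<in>?Kn. Poly_Mapping.lookup r e * x1 ^ Poly_Mapping.lookup e 1 *
      x3 ^ Poly_Mapping.lookup e 3) = 0" if "x1 \<noteq> 0 \<or> x3 \<noteq> 0" for x1 x3
    by (rule binary_vanishing[where \<psi> = "\<lambda>e. Poly_Mapping.lookup e 2"
          and b = "Poly_Mapping.lookup e0 2 + n"])
       (use deg' red24 vanishing_sum_eq_0[OF vanishing that] in \<open>auto simp: add.commute\<close>)
  have "(\<Sum>e\<in>{e \<in> ?Kn. Poly_Mapping.lookup e 3 = Poly_Mapping.lookup e0 3}.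
      Poly_Mapping.lookup r e) = 0"
  proof (rule binary_vanishing[where \<psi> = "\<lambda>e. Poly_Mapping.lookup e 1"
        and b = "Poly_Mapping.lookup e0 1 + Poly_Mapping.lookup e0 3"])
    fix x y :: 'a assume "x \<noteq> 0 \<or> y \<noteq> 0"
    then show "(\<Sum>e\<in>?Kn. Poly_Mapping.lookup r e * x ^ Poly_Mapping.lookup e 3 *
        y ^ Poly_Mapping.lookup e 1) = 0"
      using slice[of y x] by (simp add: mult_ac disj_commute)
  qed (use deg' red13 in force)+
  moreover have "{e \<in> ?Kn. Poly_Mapping.lookup e 3 = Poly_Mapping.lookup e0 3} = {e0}"
  proof -
    have "e = e0" if "e \<in> ?Kn" "Poly_Mapping.lookup e 3 = Poly_Mapping.lookup e0 3" for e
      using that deg'[of e] by (intro exponent_eqI) (auto simp: n_def)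
    then show ?thesis
      using e0 by (auto simp: n_def)
  qed
  ultimately show False
    using e0 by (simp add: in_keys_iff)
qed

text \<open>
  For \<open>l = 1\<close> one degree may contain a single further reduced monomial
  \<open>x\<^sub>4\<^sup>a x\<^sub>2\<^sup>b\<^sup>-\<^sup>a\<close> with \<open>q \<le> a \<le> 2 q - 2\<close>. As a function it agrees with
  \<open>x\<^sub>4\<^sup>a\<^sup>-\<^sup>q\<^sup>+\<^sup>1\<close> where \<open>x\<^sub>2 = 1\<close>, so its coefficient is minus a form of degree \<open>q - 1\<close> in
  \<open>x\<^sub>1, x\<^sub>3\<close> that is constant off the origin; only the zero constant is possible.
\<close>

lemma reduced_vanishing_eq_0_1:
  fixes r :: "'a::{field, finite} cox_ring"
  assumes vanishing: "vanishing r"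
    and deg: "\<And>e. e \<in> Poly_Mapping.keys r \<Longrightarrow> mon_deg 1 e = d"
    and red13: "\<And>e. e \<in> Poly_Mapping.keys r \<Longrightarrow>
      Poly_Mapping.lookup e 3 < CARD('a) \<or> Poly_Mapping.lookup e 1 = 0"
    and red24: "\<And>e. e \<in> Poly_Mapping.keys r \<Longrightarrow>
      Poly_Mapping.lookup e 4 < CARD('a) \<or> Poly_Mapping.lookup e 2 = 0 \<or>
      (Poly_Mapping.lookup e 1 = 0 \<and> Poly_Mapping.lookup e 3 = 0 \<and>
       Poly_Mapping.lookup e 4 < 2 * CARD('a) - 1)"
  shows "r = 0"
proof (rule reduced_vanishing_eq_0[OF vanishing deg red13])
  fix e assume "e \<in> Poly_Mapping.keys r"
  show "Poly_Mapping.lookup e 4 < CARD('a) \<or> Poly_Mapping.lookup e 2 = 0"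
  proof (rule ccontr)
    assume e: "\<not> ?thesis"
    define q where "q = CARD('a)"
    have q: "2 \<le> q"
      unfolding q_def by (rule card_field_ge_2)
    let ?K = "Poly_Mapping.keys r"
    let ?w = "Poly_Mapping.lookup r"
    define e0 where "e0 = e"
    define a where "a = Poly_Mapping.lookup e0 4"
    have e0: "e0 \<in> ?K" "Poly_Mapping.lookup e0 1 = 0" "Poly_Mapping.lookup e0 3 = 0"
      "0 < Poly_Mapping.lookup e0 2" "q \<le> a" "a < 2 * q - 1"
      using \<open>e \<in> ?K\<close> e red24[of e] by (auto simp: e0_def a_def q_def)
    have deg': "Poly_Mapping.lookup e 1 + Poly_Mapping.lookup e 3 + Poly_Mapping.lookup e 4 = a"
      "Poly_Mapping.lookup e 2 + Poly_Mapping.lookup e 4 = Poly_Mapping.lookup e0 2 + a"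
      if "e \<in> ?K" for e
      using deg[OF that] deg[OF e0(1)] mon_deg_eq_iff[of 1 e e0] e0 by (simp_all add: a_def)
    \<comment> \<open>If the exponent of \<open>x4\<close> is at least \<open>q\<close>, then
      \<open>x2\<close> does occur, since otherwise the degree would push that exponent above
      \<open>a\<close>. So \<open>x1\<close> and \<open>x3\<close> are absent, and the degree leaves
      only \<open>e0\<close>.\<close>
    have small: "Poly_Mapping.lookup e 4 < q" if "e \<in> ?K" "e \<noteq> e0" for e
    proof (rule ccontr)
      assume "\<not> ?thesis"
      then have "Poly_Mapping.lookup e 1 = 0" "Poly_Mapping.lookup e 3 = 0"
        using red24[OF that(1)] deg'[OF that(1)] e0 by (auto simp: q_def)
      then have "e = e0"
        using deg'[OF that(1)] e0 by (intro exponent_eqI) (auto simp: a_def)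
      then show False
        using that by simp
    qed
    \<comment> \<open>The lowered exponent lies between 1 and \<open>q - 1\<close>; being positive,
      it gives the same function as \<open>a\<close> also at 0. Now all exponents not exceeding this
      bound allow \<open>univariate_vanishing\<close>.\<close>
    define \<phi> where "\<phi> e = (if e = e0 then a - (q - 1) else Poly_Mapping.lookup e 4)" for e
    define K where "K = {e \<in> ?K. \<phi> e = a - (q - 1)}"
    have slice: "(\<Sum>e\<in>K. ?w e * x1 ^ Poly_Mapping.lookup e 1 * x3 ^ Poly_Mapping.lookup e 3) = 0"
      if "x1 \<noteq> 0 \<or> x3 \<noteq> 0" for x1 x3
      unfolding K_def
    proof (rule univariate_vanishing)
      fix x :: 'a
      have "x ^ \<phi> e = x ^ Poly_Mapping.lookup e 4" for e
      proof (cases "e = e0")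
        case True
        have "x ^ (a - (q - 1)) * x ^ (q - 1) = x ^ a"
          using e0 by (simp flip: power_add)
        then have "x ^ (a - (q - 1)) = x ^ a"
          using q e0 power_card_minus_1[of x] by (cases "x = 0") (auto simp: power_0_left simp flip: q_def)
        then show ?thesis
          using True by (simp add: \<phi>_def a_def)
      qed (simp add: \<phi>_def)
      then show "(\<Sum>e\<in>?K. ?w e * x1 ^ Poly_Mapping.lookup e 1 * x3 ^ Poly_Mapping.lookup e 3 *
          x ^ \<phi> e) = 0"
        using vanishing_sum_eq_0[OF vanishing that, of 1 x] by simp
    qed (use q e0 small in \<open>auto simp: \<phi>_def simp flip: q_def\<close>)
    have K: "e0 \<in> K" "finite K"
      using e0 by (auto simp: K_def \<phi>_def)
    have deg_K: "Poly_Mapping.lookup e 1 + Poly_Mapping.lookup e 3 = q - 1"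
      if "e \<in> K" "e \<noteq> e0" for e
      using that deg'[of e] q e0 by (auto simp: K_def \<phi>_def)
    let ?S = "{e \<in> K. Poly_Mapping.lookup e 3 = q - 1}"
    \<comment> \<open>Setting \<open>x1 = 1\<close> isolates the coefficient of the power
      \<open>q - 1\<close> of \<open>x3\<close>. The exponent of \<open>x3\<close> in
      \<open>e0\<close> is 0, so \<open>e0\<close> is not in \<open>?S\<close>.\<close>
    have S: "(\<Sum>e\<in>?S. ?w e) = 0"
    proof (rule univariate_vanishing[OF K(2)])
      show "Poly_Mapping.lookup e 3 < CARD('a)" if "e \<in> K" for e
        using deg_K[OF that] q e0 by (cases "e = e0") (auto simp flip: q_def)
      show "(\<Sum>e\<in>K. ?w e * x ^ Poly_Mapping.lookup e 3) = 0" for x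
        using slice[of 1 x] by simp
    qed
    \<comment> \<open>At \<open>x1 = 0\<close>, \<open>x3 = 1\<close> the same coefficient appears
      together with that of \<open>e0\<close>, which is thus zero.\<close>
    have "0 = (\<Sum>e\<in>K. ?w e * 0 ^ Poly_Mapping.lookup e 1 * 1 ^ Poly_Mapping.lookup e 3)"
      using slice[of 0 1] by simp
    also have "\<dots> = (\<Sum>e\<in>K. if Poly_Mapping.lookup e 1 = 0 then ?w e else 0)"
      by (intro sum.cong) (auto simp: power_0_left)
    also have "\<dots> = (\<Sum>e\<in>{e \<in> K. Poly_Mapping.lookup e 1 = 0}. ?w e)"
      using K(2) by (rule sum.inter_filter[symmetric])
    also have "{e \<in> K. Poly_Mapping.lookup e 1 = 0} = insert e0 ?S"
      using K(1) e0 deg_K by (auto, fastforce+)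
    also have "(\<Sum>e\<in>insert e0 ?S. ?w e) = ?w e0 + (\<Sum>e\<in>?S. ?w e)"
      using K(2) e0 q by (intro sum.insert) auto
    finally show False
      using S e0(1) by (simp add: in_keys_iff)
  qed
qed

section \<open>Generators of the vanishing ideal\<close>

text \<open>The remainder of a vanishing \<open>f\<close> differs from \<open>f\<close> by a
  combination of vanishing generators, so it vanishes too and \<open>reduced\<close> makes it zero.
  This is the argument common to \<open>l = 1\<close> and \<open>1 < l\<close>.\<close>

lemma vanishing_ideal_eqI:
  fixes L :: "('a::field cox_ring \<times> (4 \<Rightarrow>\<^sub>0 nat)) set"
  assumes lead: "\<And>g u. (g, u) \<in> L \<Longrightarrow> leading_exponent g u"
    and hom: "\<And>g u. (g, u) \<in> L \<Longrightarrow> homogeneous l g"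
    and vanishing: "\<And>g u. (g, u) \<in> L \<Longrightarrow> vanishing g"
    and reduced: "\<And>(r :: 'a cox_ring) d. vanishing r \<Longrightarrow> (\<And>e. e \<in> Poly_Mapping.keys r \<Longrightarrow> mon_deg l e = d) \<Longrightarrow>
      (\<And>e g u v. e \<in> Poly_Mapping.keys r \<Longrightarrow> (g, u) \<in> L \<Longrightarrow> e \<noteq> u + v) \<Longrightarrow> r = 0"
  shows "vanishing_ideal l (hirzebruch_points l) = ideal_gen (fst ` L)"
  unfolding vanishing_ideal_hirzebruch_points
proof (intro subset_antisym ideal_gen_subset_ideal_gen subsetI)
  fix f :: "'a cox_ring" assume "f \<in> {f. homogeneous l f \<and> vanishing f}"
  then obtain d where f: "vanishing f" "\<And>e. e \<in> Poly_Mapping.keys f \<Longrightarrow> mon_deg l e = d"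
    by (auto simp: homogeneous_def)
  obtain r where r: "f - r \<in> ideal_gen (fst ` L)"
    "\<And>e. e \<in> Poly_Mapping.keys r \<Longrightarrow> mon_deg l e = d"
    "\<And>e g u v. e \<in> Poly_Mapping.keys r \<Longrightarrow> (g, u) \<in> L \<Longrightarrow> e \<noteq> u + v"
    by (rule division[of L l f d]) (use lead hom f(2) in blast)+
  have "vanishing r"
    unfolding vanishing_def
  proof (intro allI impI)
    fix P :: "4 \<Rightarrow> 'a"
    assume P: "(P 1 \<noteq> 0 \<or> P 3 \<noteq> 0) \<and> (P 2 \<noteq> 0 \<or> P 4 \<noteq> 0)"
    have "eval_at (f - r) P = 0"
      using r(1) by (rule eval_at_ideal_gen) (use vanishing P in \<open>auto simp: vanishing_def\<close>)
    moreover have "eval_at f P = 0"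
      using f(1) P unfolding vanishing_def by blast
    ultimately show "eval_at r P = 0"
      by simp
  qed
  then have "r = 0"
    by (rule reduced[of r d]) (use r(2,3) in blast)+
  then show "f \<in> ideal_gen (fst ` L)"
    using r(1) by simp
next
  fix g assume "g \<in> fst ` L"
  then show "g \<in> ideal_gen {f. homogeneous l f \<and> vanishing f}"
    using hom vanishing by (auto intro!: ideal_gen_base)
qed

text \<open>A positive multiple of \<open>q - 1\<close> as exponent turns a value into the indicator
  of being nonzero. With indicators \<open>a\<close> of \<open>x1\<close> and \<open>c\<close> of
  \<open>x3\<close>, both \<open>F4\<close> and \<open>F4'\<close> evaluate to
  \<open>x4 * x2 * (1 - a) * (1 - c)\<close>. For \<open>F4\<close> this takes \<open>1 < l\<close>,
  so that the mixed term still contains \<open>x1\<close>.\<close>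

lemma vanishing_generators:
  fixes q :: nat
  assumes q: "q = CARD('a::{field, finite})"
  shows "vanishing (F1 q :: 'a cox_ring)"
    and "0 < l \<Longrightarrow> vanishing (F2 l q :: 'a cox_ring)"
    and "0 < l \<Longrightarrow> vanishing (F3 l q :: 'a cox_ring)"
    and "1 < l \<Longrightarrow> vanishing (F4 l q :: 'a cox_ring)"
    and "vanishing (F4' q :: 'a cox_ring)"
proof -
  have q2: "2 \<le> q"
    unfolding q by (rule card_field_ge_2)
  have pow: "x ^ (q - 1) = (if x = 0 then 0 else 1)" for x :: 'a
    using q2 power_card_minus_1[of x] by (auto simp: q)
  have pow_l: "x ^ ((q - 1) * k) = (if x = 0 then 0 else 1)" if "0 < k" for x :: 'a and k
    using that unfolding power_mult pow by simp
  have pow_q: "x ^ q = x" for x :: 'a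
    using pow[of x] q2 power_Suc[of x "q - 1"] by (auto split: if_splits)
  have pow_2: "x ^ (2 * (q - 1)) = (if x = 0 then 0 else 1)" for x :: 'a
    using pow_l[of 2 x] by (simp add: mult.commute)
  have pow_2q: "x ^ (2 * q - 1) = x" for x :: 'a
  proof -
    have "2 * q - 1 = Suc (2 * (q - 1))"
      using q2 by simp
    then show ?thesis
      by (simp only: power_Suc pow_2) simp
  qed
  note ev = eval_at_add eval_at_diff eval_at_mult eval_at_power eval_at_Var
  show "vanishing (F1 q :: 'a cox_ring)"
    unfolding vanishing_def F1_def ev pow by auto
  show "vanishing (F2 l q :: 'a cox_ring)" if "0 < l"
    unfolding vanishing_def F2_def ev pow pow_l[OF that] by auto
  show "vanishing (F3 l q :: 'a cox_ring)" if "0 < l"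
    unfolding vanishing_def F3_def ev pow pow_l[OF that] by auto
  show "vanishing (F4 l q :: 'a cox_ring)" if "1 < l"
  proof -
    have "0 < l" "0 < l - 1"
      using that by auto
    then show ?thesis
      unfolding vanishing_def F4_def ev pow pow_q by (auto simp only: pow_l) (auto simp: mult_ac)
  qed
  show "vanishing (F4' q :: 'a cox_ring)"
    unfolding vanishing_def F4'_def ev pow pow_2 pow_2q by auto
qed

text \<open>Not being divisible by the leading monomials of \<open>F1\<close> and \<open>F4\<close>
  amounts to the two conditions of \<open>reduced_vanishing_eq_0\<close>.\<close>

lemma vanishing_ideal_eq_F1_F4:
  assumes q: "q = CARD('a::{field, finite})" and l: "1 < l"
  shows "(vanishing_ideal l (hirzebruch_points l) :: 'a cox_ring set) = ideal_gen {F1 q, F4 l q}"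
proof -
  have q2: "2 \<le> q"
    unfolding q by (rule card_field_ge_2)
  let ?L = "{(F1 q :: 'a cox_ring, expo 1 0 q 0), (F4 l q, expo 0 1 0 q)}"
  have "vanishing_ideal l (hirzebruch_points l) = ideal_gen (fst ` ?L)"
  proof (rule vanishing_ideal_eqI)
    fix r :: "'a cox_ring" and d
    assume r: "vanishing r" "\<And>e. e \<in> Poly_Mapping.keys r \<Longrightarrow> mon_deg l e = d"
      and red: "\<And>e g u v. e \<in> Poly_Mapping.keys r \<Longrightarrow> (g, u) \<in> ?L \<Longrightarrow> e \<noteq> u + v"
    show "r = 0"
    proof (rule reduced_vanishing_eq_0[OF r])
      fix e assume e: "e \<in> Poly_Mapping.keys r"
      have "e \<noteq> expo 1 0 q 0 + v" "e \<noteq> expo 0 1 0 q + v" for v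
        using red[OF e] by blast+
      then show "Poly_Mapping.lookup e 3 < CARD('a) \<or> Poly_Mapping.lookup e 1 = 0"
        "Poly_Mapping.lookup e 4 < CARD('a) \<or> Poly_Mapping.lookup e 2 = 0"
        using expo_not_divides[of e 1 0 q 0] expo_not_divides[of e 0 1 0 q] by (auto simp flip: q)
    qed
  qed (use l in \<open>auto simp del: One_nat_def intro: leading_exponent_F1[OF q2] leading_exponent_F4[OF q2]
        homogeneous_F1[OF q2] homogeneous_F4[OF q2] vanishing_generators[OF q]\<close>)
  then show ?thesis
    by simp
qed

lemma vanishing_ideal_1_eq:
  assumes q: "q = CARD('a::{field, finite})"
  shows "(vanishing_ideal 1 (hirzebruch_points 1) :: 'a cox_ring set) =
    ideal_gen {F1 q, F2 1 q, F3 1 q, F4' q}"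
proof -
  have q2: "2 \<le> q"
    unfolding q by (rule card_field_ge_2)
  let ?L = "{(F1 q :: 'a cox_ring, expo 1 0 q 0), (F2 1 q, expo 1 1 0 q),
    (F3 1 q, expo 0 1 1 q), (F4' q, expo 0 1 0 (2 * q - 1))}"
  have "vanishing_ideal 1 (hirzebruch_points 1) = ideal_gen (fst ` ?L)"
  proof (rule vanishing_ideal_eqI)
    fix r :: "'a cox_ring" and d
    assume r: "vanishing r" "\<And>e. e \<in> Poly_Mapping.keys r \<Longrightarrow> mon_deg 1 e = d"
      and red: "\<And>e g u v. e \<in> Poly_Mapping.keys r \<Longrightarrow> (g, u) \<in> ?L \<Longrightarrow> e \<noteq> u + v"
    show "r = 0"
    proof (rule reduced_vanishing_eq_0_1[OF r])
      fix e assume e: "e \<in> Poly_Mapping.keys r"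
      have "e \<noteq> expo 1 0 q 0 + v" "e \<noteq> expo 1 1 0 q + v" "e \<noteq> expo 0 1 1 q + v"
        "e \<noteq> expo 0 1 0 (2 * q - 1) + v" for v
        using red[OF e] by blast+
      note this[THEN expo_not_divides]
      then show "Poly_Mapping.lookup e 3 < CARD('a) \<or> Poly_Mapping.lookup e 1 = 0"
        "Poly_Mapping.lookup e 4 < CARD('a) \<or> Poly_Mapping.lookup e 2 = 0 \<or>
        (Poly_Mapping.lookup e 1 = 0 \<and> Poly_Mapping.lookup e 3 = 0 \<and>
         Poly_Mapping.lookup e 4 < 2 * CARD('a) - 1)"
        by (auto simp flip: q)
    qed
  qed (auto simp del: One_nat_def intro: leading_exponent_F1[OF q2] leading_exponent_F2[OF q2] leading_exponent_F3[OF q2]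
        leading_exponent_F4'[OF q2] homogeneous_F1[OF q2] homogeneous_F2[OF q2] homogeneous_F3[OF q2]
        homogeneous_F4'[OF q2] vanishing_generators[OF q])
  then show ?thesis
    by simp
qed

theorem theorem5p3:
  fixes l q :: nat
  assumes "CARD('a::{field, finite}) = q"
    and "0 < l"
  shows "(1 < l \<longrightarrow>
           (vanishing_ideal l (hirzebruch_points l) :: 'a cox_ring set)
             = ideal_gen {F1 q, F2 l q, F3 l q, F4 l q} \<and>
           ideal_gen {F1 q, F2 l q, F3 l q, F4 l q} = ideal_gen {F1 q, F4 l q :: 'a cox_ring} \<and>
           minimal_generating_set {F1 q, F4 l q :: 'a cox_ring}
             (vanishing_ideal l (hirzebruch_points l))) \<and>
         (l = 1 \<longrightarrow>
           (vanishing_ideal 1 (hirzebruch_points 1) :: 'a cox_ring set)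
             = ideal_gen {F1 q, F2 1 q, F3 1 q, F4' q} \<and>
           minimal_generating_set {F1 q, F2 1 q, F3 1 q, F4' q :: 'a cox_ring}
             (vanishing_ideal 1 (hirzebruch_points 1)))"
proof (intro conjI impI)
  have q: "q = CARD('a)" and q2: "2 \<le> q"
    using assms(1) card_field_ge_2[where ?'a = 'a] by auto
  {
    assume l: "1 < l"
    note I = vanishing_ideal_eq_F1_F4[OF q l]
    \<comment> \<open>Being homogeneous and vanishing, \<open>F2\<close> and \<open>F3\<close> lie
      in the ideal already known to be generated by \<open>F1\<close> and \<open>F4\<close>; no
      explicit combination has to be exhibited.\<close>
    have "F2 l q \<in> (vanishing_ideal l (hirzebruch_points l) :: 'a cox_ring set)"
      "F3 l q \<in> (vanishing_ideal l (hirzebruch_points l) :: 'a cox_ring set)"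
      unfolding vanishing_ideal_hirzebruch_points
      using homogeneous_F2[OF q2] homogeneous_F3[OF q2] vanishing_generators[OF q] assms(2)
      by (auto intro!: ideal_gen_base)
    then have "{F1 q, F2 l q, F3 l q, F4 l q} \<subseteq> ideal_gen {F1 q, F4 l q :: 'a cox_ring}"
      unfolding I by (auto intro!: ideal_gen_base)
    then show eq: "ideal_gen {F1 q, F2 l q, F3 l q, F4 l q} = ideal_gen {F1 q, F4 l q :: 'a cox_ring}"
      by (intro subset_antisym ideal_gen_subset_ideal_gen) (auto intro!: ideal_gen_base)
    then show "(vanishing_ideal l (hirzebruch_points l) :: 'a cox_ring set)
        = ideal_gen {F1 q, F2 l q, F3 l q, F4 l q}"
      using I by simp
    show "minimal_generating_set {F1 q, F4 l q :: 'a cox_ring}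
        (vanishing_ideal l (hirzebruch_points l))"
    proof (rule minimal_generating_setI)
      fix x :: "'a cox_ring" assume "x \<in> {F1 q, F4 l q}"
      then consider "x = F1 q" | "x = F4 l q"
        by blast
      then show "x \<notin> ideal_gen ({F1 q, F4 l q} - {x})"
      proof cases
        case 1
        show ?thesis
          unfolding 1 by (rule F1_notin_ideal_gen[OF q2, of _ l]) blast
      next
        case 2
        show ?thesis
          unfolding 2 by (rule F4_notin_ideal_gen[OF q2]) blast
      qed
    qed (simp add: I)
  }
  show I: "(vanishing_ideal 1 (hirzebruch_points 1) :: 'a cox_ring set)
      = ideal_gen {F1 q, F2 1 q, F3 1 q, F4' q}"
    by (rule vanishing_ideal_1_eq[OF q])
  show "minimal_generating_set {F1 q, F2 1 q, F3 1 q, F4' q :: 'a cox_ring}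
      (vanishing_ideal 1 (hirzebruch_points 1))"
  proof (rule minimal_generating_setI)
    fix x :: "'a cox_ring" assume "x \<in> {F1 q, F2 1 q, F3 1 q, F4' q}"
    then consider "x = F1 q" | "x = F2 1 q" | "x = F3 1 q" | "x = F4' q"
      by blast
    then show "x \<notin> ideal_gen ({F1 q, F2 1 q, F3 1 q, F4' q} - {x})"
    proof cases
      case 1
      show ?thesis
        unfolding 1 by (rule F1_notin_ideal_gen[OF q2, of _ 1]) blast
    next
      case 2
      show ?thesis
        unfolding 2 by (rule F2_notin_ideal_gen[OF q2]) blast
    next
      case 3
      show ?thesis
        unfolding 3 by (rule F3_notin_ideal_gen[OF q2]) blast
    next
      case 4
      show ?thesis
        unfolding 4 by (rule F4'_notin_ideal_gen[OF q2, of _ 1]) blast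
    qed
  qed (rule I[symmetric])
qed

end
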